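(* Let $D\in\mathscr{D}(S^1,* )$ be a based chord diagram and let $\bar D$ denote its mirror image, labelled by the canonical ordering moving counter-clockwise from the basepoint. Let $\vec{G}$ be the linearly ordered intersection graph of $D$ and $\bar{G}$ the linearly ordered intersection graph of $\bar D$. Then $$\vec{P}_{\vec{G}}(x)=\vec{P}_{\bar{G}}(x).$$
   Context: $\mathscr{D}(S^1,* )$ is the collection of chord diagrams: a circle $S^1$ (traversed counter-clockwise) with a basepoint $*$ and finitely many chords whose endpoints are pairwise distinct points of $S^1\setminus\{*\}$. The chords have a canonical ordering: travelling counter-clockwise from $*$, chords are labelled $1,2,\ldots$ in the order in which their first endpoints are encountered. The mirror image $\bar D$ is the image of $D$ (with its basepoint) under a reflection of the plane; i.e. the cyclic word of chord endpoints read counter-clockwise from the basepoint in $\bar D$ is the reverse of that of $D$. The linearly ordered intersection graph of a chord diagram has vertices corresponding to the chords, labelled by the canonical ordering; two vertices are adjacent iff the chords cross (their endpoints interleave on $S^1$); an edge is directed from the smaller label to the larger label. The skew-adjacency matrix $\vec{A}_{\vec{G}}$ of a linearly ordered graph has $(i,j)$ entry $1$ if $i,j$ are adjacent and $i<j$, $-1$ if $i,j$ are adjacent and $i>j$, and $0$ otherwise, and $\vec{P}_{\vec{G}}(x)=\det(xI-\vec{A}_{\vec{G}})$. *)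

theory Defs
  imports
    "HOL-Analysis.Complex_Transcendental"
    "Jordan_Normal_Form.Char_Poly"
    "Graph_Theory.Pair_Digraph"
begin

(* A chord is represented by the set of its two endpoints. *)
record chord_diagram =
  basepoint :: complex
  chords :: "complex set set"

definition based_chord_diagrams :: "chord_diagram set" where
  "based_chord_diagrams = {D.
     basepoint D \<in> sphere 0 1 \<and>
     finite (chords D) \<and>
     (\<forall>c \<in> chords D. c \<subseteq> sphere 0 1 - {basepoint D} \<and> card c = 2) \<and>
     disjoint (chords D)}"

(* The angle, in [0, 2 pi), travelled counter-clockwise from the basepoint to z. *)
definition position :: "chord_diagram \<Rightarrow> complex \<Rightarrow> real" where
  "position D z = Arg2pi (z / basepoint D)"

definition first_position :: "chord_diagram \<Rightarrow> complex set \<Rightarrow> real" where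
  "first_position D c = Min (position D ` c)"

definition last_position :: "chord_diagram \<Rightarrow> complex set \<Rightarrow> real" where
  "last_position D c = Max (position D ` c)"

definition chord_label :: "chord_diagram \<Rightarrow> complex set \<Rightarrow> nat" where
  "chord_label D c = Suc (card {d \<in> chords D. first_position D d < first_position D c})"

(* The endpoints interleave: starting at the basepoint, one meets them in the cyclic
   pattern c d c d or d c d c. *)
definition chords_cross :: "chord_diagram \<Rightarrow> complex set \<Rightarrow> complex set \<Rightarrow> bool" where
  "chords_cross D c d \<longleftrightarrow>
     (first_position D c < first_position D d \<and>
      first_position D d < last_position D c \<and>
      last_position D c < last_position D d) \<or>
     (first_position D d < first_position D c \<and>
      first_position D c < last_position D d \<and>
      last_position D d < last_position D c)"

(* Reflection of the plane in the line through 0 and v, for v on the unit circle; these are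
   exactly the reflections that preserve the unit circle. *)
definition reflection :: "complex \<Rightarrow> complex \<Rightarrow> complex" where
  "reflection v z = v\<^sup>2 * cnj z"

definition mirror_image :: "complex \<Rightarrow> chord_diagram \<Rightarrow> chord_diagram" where
  "mirror_image v D =
     \<lparr> basepoint = reflection v (basepoint D),
       chords = (\<lambda>c. reflection v ` c) ` chords D \<rparr>"


(* A linearly ordered graph with n vertices is encoded as a digraph on the labels {1..n} whose
   arcs are the edges, each directed from its smaller to its larger label. *)
definition intersection_graph :: "chord_diagram \<Rightarrow> nat pair_pre_digraph" where
  "intersection_graph D =
     \<lparr> pverts = chord_label D ` chords D,
       parcs = {(chord_label D c, chord_label D d) | c d.
          c \<in> chords D \<and> d \<in> chords D \<and> chords_cross D c d \<and>
          chord_label D c < chord_label D d} \<rparr>"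

definition adjacent_labels :: "nat pair_pre_digraph \<Rightarrow> nat \<Rightarrow> nat \<Rightarrow> bool" where
  "adjacent_labels G i j \<longleftrightarrow> (i, j) \<in> parcs G \<or> (j, i) \<in> parcs G"

(* Matrix indices start at 0, vertex labels at 1. *)
definition skew_adjacency_matrix :: "nat pair_pre_digraph \<Rightarrow> int mat" where
  "skew_adjacency_matrix G =
     mat (card (pverts G)) (card (pverts G)) (\<lambda>(i, j).
       if adjacent_labels G (Suc i) (Suc j) \<and> i < j then 1
       else if adjacent_labels G (Suc i) (Suc j) \<and> i > j then - 1
       else 0)"

definition skew_char_poly :: "nat pair_pre_digraph \<Rightarrow> int poly" where
  "skew_char_poly G = char_poly (skew_adjacency_matrix G)"

end

theory Submission
  imports Defs
begin

text \<open>
  A reflection sends the angular position \<open>t\<close> of an endpoint to \<open>2 * pi - t\<close>. So first and last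
  endpoints of a chord trade places, and the mirror image orders the chords by their last endpoints,
  from the latest to the earliest, whereas the original diagram orders them by their first endpoints.
  On arbitrary pairs of chords these two orders are unrelated. Only the entries at crossing pairs are
  nonzero, however, and the chord of a crossing pair that starts first also ends first: on every
  crossing pair the two orders disagree. Indexed by chords instead of labels, the skew-adjacency
  matrix of the mirror image is thus the negative of that of the diagram, which is its transpose
  (\<open>chord_sign_mirror_image\<close>).

  The two labellings are two enumerations of the same set of chords, so the actual matrices agree
  up to this transposition and a simultaneous permutation of rows and columns, and neither changes
  the characteristic polynomial (\<open>char_poly_eq_if_reindexed\<close>).
\<close>

section \<open>Characteristic polynomials and enumerations of the index set\<close>

text \<open>
  Rows and columns are permuted in turn, the latter through a transposition. Each of the two steps
  contributes the sign of the permutation, and the signs cancel.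
\<close>

lemma det_permute_rows_columns:
  fixes A :: "'a :: comm_ring_1 mat"
  assumes A: "A \<in> carrier_mat n n" and p: "p permutes {0..<n}"
  shows "det (mat n n (\<lambda>(i, j). A $$ (p i, p j))) = det A"
proof -
  define R where "R = mat n n (\<lambda>(i, j). A $$ (p i, j))"
  have R: "R\<^sup>T \<in> carrier_mat n n" by (simp add: R_def)
  have less: "p i < n" if "i < n" for i
    using permutes_in_image[OF p, of i] that by simp
  have "mat n n (\<lambda>(i, j). A $$ (p i, p j)) = (mat n n (\<lambda>(i, j). R\<^sup>T $$ (p i, j)))\<^sup>T"
    by (rule eq_matI) (auto simp: R_def less)
  then have "det (mat n n (\<lambda>(i, j). A $$ (p i, p j))) = det (mat n n (\<lambda>(i, j). R\<^sup>T $$ (p i, j)))"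
    by (simp add: det_transpose[of _ n])
  also have "\<dots> = signof p * det R"
    unfolding det_permute_rows[OF R p] by (subst det_transpose[of _ n]) (simp_all add: R_def)
  also have "\<dots> = (signof p * signof p) * det A"
    by (simp add: R_def det_permute_rows[OF A p] mult.assoc)
  also have "signof p * signof p = (1 :: 'a)"
    by (simp add: sign_def)
  finally show ?thesis by simp
qed

lemma char_poly_permute_rows_columns:
  fixes A :: "'a :: comm_ring_1 mat"
  assumes A: "A \<in> carrier_mat n n" and p: "p permutes {0..<n}"
  shows "char_poly (mat n n (\<lambda>(i, j). A $$ (p i, p j))) = char_poly A"
proof -
  have less: "p i < n" if "i < n" for i
    using permutes_in_image[OF p, of i] that by simp
  have inj: "p i = p j \<longleftrightarrow> i = j" for i j
    using permutes_inj[OF p] by (auto dest: injD)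
  have "char_poly_matrix (mat n n (\<lambda>(i, j). A $$ (p i, p j))) =
      mat n n (\<lambda>(i, j). char_poly_matrix A $$ (p i, p j))"
    using A by (intro eq_matI) (auto simp: char_poly_matrix_def less inj)
  then show ?thesis
    using det_permute_rows_columns[OF char_poly_matrix_closed[OF A] p]
    by (simp add: char_poly_def)
qed

text \<open>
  Two enumerations \<open>f\<close> and \<open>g\<close> of the same index set differ by the permutation \<open>g \<circ> f\<^sup>-\<^sup>1\<close>. Matrices
  that are indexed by a set of chords are compared in this form, without mention of permutations.
\<close>

lemma char_poly_eq_if_reindexed:
  fixes A B :: "'a :: comm_ring_1 mat"
  assumes A: "A \<in> carrier_mat n n" and B: "B \<in> carrier_mat n n"
    and f: "bij_betw f S {0..<n}" and g: "bij_betw g S {0..<n}"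
    and eq: "\<And>c d. c \<in> S \<Longrightarrow> d \<in> S \<Longrightarrow> A $$ (f c, f d) = B $$ (g c, g d)"
  shows "char_poly A = char_poly B"
proof -
  define h where "h = inv_into S f"
  define p where "p i = (if i < n then g (h i) else i)" for i
  have h: "bij_betw h {0..<n} S"
    unfolding h_def using f by (rule bij_betw_inv_into)
  have hS: "h i \<in> S" and fh: "f (h i) = i" if "i < n" for i
    using that bij_betwE[OF h] bij_betw_inv_into_right[OF f] by (auto simp: h_def)
  have "bij_betw (g \<circ> h) {0..<n} {0..<n}"
    using h g by (rule bij_betw_trans)
  then have "bij_betw p {0..<n} {0..<n}"
    by (rule bij_betw_cong[THEN iffD1, rotated]) (simp add: p_def)
  then have p: "p permutes {0..<n}"
    by (rule bij_imp_permutes) (simp add: p_def)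
  have "A = mat n n (\<lambda>(i, j). B $$ (p i, p j))"
    using A
  proof (intro eq_matI)
    fix i j assume "i < dim_row (mat n n (\<lambda>(i, j). B $$ (p i, p j)))"
      and "j < dim_col (mat n n (\<lambda>(i, j). B $$ (p i, p j)))"
    then show "A $$ (i, j) = mat n n (\<lambda>(i, j). B $$ (p i, p j)) $$ (i, j)"
      using eq[OF hS hS, of i j] by (simp add: fh p_def)
  qed auto
  then show ?thesis
    using char_poly_permute_rows_columns[OF B p] by simp
qed

section \<open>Ranks in a finite set\<close>

lemma rank_less_iff:
  fixes f :: "'a \<Rightarrow> 'b :: linorder"
  assumes "finite S" and "c \<in> S" and "d \<in> S"
  shows "card {x \<in> S. f x < f c} < card {x \<in> S. f x < f d} \<longleftrightarrow> f c < f d"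
proof
  assume "f c < f d"
  then have "{x \<in> S. f x < f c} \<subset> {x \<in> S. f x < f d}"
    using assms by auto
  then show "card {x \<in> S. f x < f c} < card {x \<in> S. f x < f d}"
    using assms by (intro psubset_card_mono) auto
next
  assume *: "card {x \<in> S. f x < f c} < card {x \<in> S. f x < f d}"
  show "f c < f d"
  proof (rule ccontr)
    assume "\<not> f c < f d"
    then have "card {x \<in> S. f x < f d} \<le> card {x \<in> S. f x < f c}"
      using assms by (intro card_mono) auto
    with * show False by simp
  qed
qed

lemma bij_betw_rank:
  fixes f :: "'a \<Rightarrow> 'b :: linorder"
  assumes fin: "finite S" and inj: "inj_on f S"
  shows "bij_betw (\<lambda>c. card {x \<in> S. f x < f c}) S {0..<card S}"
proof -
  let ?r = "\<lambda>c. card {x \<in> S. f x < f c}"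
  have r: "inj_on ?r S"
  proof (rule inj_onI)
    fix c d assume S: "c \<in> S" "d \<in> S" and "?r c = ?r d"
    then have "f c = f d"
      using rank_less_iff[OF fin S, of f] rank_less_iff[OF fin S(2) S(1), of f] by force
    then show "c = d" using inj S by (auto dest: inj_onD)
  qed
  have "?r ` S \<subseteq> {0..<card S}"
    using fin by (auto intro!: psubset_card_mono)
  moreover have "card (?r ` S) = card S"
    using r by (rule card_image)
  ultimately have "?r ` S = {0..<card S}"
    by (intro card_subset_eq) auto
  with r show ?thesis by (simp add: bij_betw_def)
qed

section \<open>The skew-adjacency matrix indexed by chords\<close>

lemma inj_on_position:
  assumes "basepoint D \<in> sphere 0 1"
  shows "inj_on (position D) (sphere 0 1)"
proof (rule inj_onI)
  fix z w assume z: "z \<in> sphere 0 1" and w: "w \<in> sphere 0 1" and "position D z = position D w"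
  then have "z / basepoint D = w / basepoint D"
    using assms complex_norm_eq_1_exp[of "z / basepoint D"] complex_norm_eq_1_exp[of "w / basepoint D"]
    by (simp add: position_def norm_divide)
  then show "z = w" using assms by auto
qed

text \<open>
  Chords are pairwise disjoint, so no two of them have the same first endpoint: the canonical
  labelling is a strict enumeration.
\<close>

lemma inj_on_first_position:
  assumes D: "D \<in> based_chord_diagrams"
  shows "inj_on (first_position D) (chords D)"
proof (rule inj_onI)
  fix c d assume cd: "c \<in> chords D" "d \<in> chords D" and eq: "first_position D c = first_position D d"
  have attained: "\<exists>z \<in> e. z \<in> sphere 0 1 \<and> first_position D e = position D z"
    if "e \<in> chords D" for e
  proof -
    have sub: "e \<subseteq> sphere 0 1" and card: "card e = 2"
      using D that by (auto simp: based_chord_diagrams_def)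
    from card have "finite e" "e \<noteq> {}"
      by (auto intro: card_ge_0_finite)
    then have "first_position D e \<in> position D ` e"
      unfolding first_position_def by (intro Min_in) auto
    with sub show ?thesis by blast
  qed
  obtain z w where z: "z \<in> c" "z \<in> sphere 0 1" "first_position D c = position D z"
    and w: "w \<in> d" "w \<in> sphere 0 1" "first_position D d = position D w"
    using attained[OF cd(1)] attained[OF cd(2)] by blast
  have "z = w"
    using inj_on_position[of D] D eq z w by (auto simp: based_chord_diagrams_def dest: inj_onD)
  then have "c \<inter> d \<noteq> {}" using z w by auto
  then show "c = d"
    using D cd unfolding based_chord_diagrams_def by (auto simp: pairwise_def disjnt_def)
qed

text \<open>Matrix indices start at 0, labels at 1.\<close>

definition chord_index :: "chord_diagram \<Rightarrow> complex set \<Rightarrow> nat" where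
  "chord_index D c = chord_label D c - 1"

lemma chord_label_eq_Suc_index: "chord_label D c = Suc (chord_index D c)"
  by (simp add: chord_index_def chord_label_def)

lemma bij_betw_chord_index:
  assumes "D \<in> based_chord_diagrams"
  shows "bij_betw (chord_index D) (chords D) {0..<card (chords D)}"
proof -
  have "chord_index D = (\<lambda>c. card {d \<in> chords D. first_position D d < first_position D c})"
    by (simp add: fun_eq_iff chord_index_def chord_label_def)
  moreover have "finite (chords D)"
    using assms by (simp add: based_chord_diagrams_def)
  ultimately show ?thesis
    using bij_betw_rank[OF _ inj_on_first_position[OF assms]] by simp
qed

lemma chord_index_less_iff:
  assumes "D \<in> based_chord_diagrams" and "c \<in> chords D" and "d \<in> chords D"
  shows "chord_index D c < chord_index D d \<longleftrightarrow> first_position D c < first_position D d"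
  using rank_less_iff[of "chords D" c d "first_position D"] assms
  by (simp add: chord_index_def chord_label_def based_chord_diagrams_def)

lemma chords_cross_sym: "chords_cross D c d \<longleftrightarrow> chords_cross D d c"
  by (auto simp: chords_cross_def)

definition chord_sign :: "chord_diagram \<Rightarrow> complex set \<Rightarrow> complex set \<Rightarrow> int" where
  "chord_sign D c d =
     (if \<not> chords_cross D c d then 0 else if first_position D c < first_position D d then 1 else - 1)"

lemma adjacent_labels_iff_chords_cross:
  assumes D: "D \<in> based_chord_diagrams" and c: "c \<in> chords D" and d: "d \<in> chords D"
  shows "adjacent_labels (intersection_graph D) (chord_label D c) (chord_label D d) \<longleftrightarrow>
         chords_cross D c d"
proof -
  have inj: "chord_label D a = chord_label D b \<longleftrightarrow> a = b" if "a \<in> chords D" "b \<in> chords D" for a b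
    using bij_betw_chord_index[OF D] that
    by (auto simp: chord_label_eq_Suc_index bij_betw_def dest: inj_onD)
  have arc: "(chord_label D a, chord_label D b) \<in> parcs (intersection_graph D) \<longleftrightarrow>
      chords_cross D a b \<and> first_position D a < first_position D b"
    if "a \<in> chords D" "b \<in> chords D" for a b
    using that chord_index_less_iff[OF D that]
    by (auto simp: intersection_graph_def inj chord_label_eq_Suc_index[symmetric])
      (auto simp: chord_label_eq_Suc_index)
  show ?thesis
    using arc[OF c d] arc[OF d c] chords_cross_sym[of D c d]
    by (auto simp: adjacent_labels_def chords_cross_def)
qed

lemma card_pverts_intersection_graph:
  assumes "D \<in> based_chord_diagrams"
  shows "card (pverts (intersection_graph D)) = card (chords D)"
  using bij_betw_chord_index[OF assms]
  by (simp add: intersection_graph_def card_image inj_on_def bij_betw_def chord_label_eq_Suc_index)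

lemma skew_adjacency_matrix_carrier:
  assumes "D \<in> based_chord_diagrams"
  shows "skew_adjacency_matrix (intersection_graph D) \<in> carrier_mat (card (chords D)) (card (chords D))"
  by (simp add: skew_adjacency_matrix_def card_pverts_intersection_graph[OF assms])

lemma skew_adjacency_matrix_chord_index:
  assumes D: "D \<in> based_chord_diagrams" and c: "c \<in> chords D" and d: "d \<in> chords D"
  shows "skew_adjacency_matrix (intersection_graph D) $$ (chord_index D c, chord_index D d) =
         chord_sign D c d"
proof -
  have "chord_index D c < card (chords D)" "chord_index D d < card (chords D)"
    using bij_betwE[OF bij_betw_chord_index[OF D]] c d by auto
  then show ?thesis
    using adjacent_labels_iff_chords_cross[OF D c d]
      chord_index_less_iff[OF D c d] chord_index_less_iff[OF D d c]
    by (auto simp: skew_adjacency_matrix_def card_pverts_intersection_graph[OF D] chord_sign_def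
        chord_label_eq_Suc_index chords_cross_def)
qed

section \<open>The effect of a reflection\<close>

lemma inj_reflection:
  assumes "norm v = 1"
  shows "inj (reflection v)"
  using assms by (intro injI) (auto simp: reflection_def)

lemma reflection_in_sphere_iff:
  assumes "norm v = 1"
  shows "reflection v z \<in> sphere 0 1 \<longleftrightarrow> z \<in> sphere 0 1"
  using assms by (simp add: reflection_def norm_mult norm_power)

lemma mirror_image_in_based_chord_diagrams:
  assumes D: "D \<in> based_chord_diagrams" and v: "norm v = 1"
  shows "mirror_image v D \<in> based_chord_diagrams"
proof -
  note inj = inj_reflection[OF v]
  have "disjoint ((`) (reflection v) ` chords D)"
  proof (rule pairwise_imageI)
    fix c d assume "c \<in> chords D" "d \<in> chords D" "c \<noteq> d"
    then have "c \<inter> d = {}"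
      using D by (auto simp: based_chord_diagrams_def pairwise_def disjnt_def)
    then show "disjnt (reflection v ` c) (reflection v ` d)"
      by (simp add: disjnt_def image_Int[OF inj, symmetric])
  qed
  then show ?thesis
    using D reflection_in_sphere_iff[OF v]
    by (fastforce simp: based_chord_diagrams_def mirror_image_def inj_eq[OF inj]
        card_image[OF inj_on_subset[OF inj subset_UNIV]])
qed

text \<open>
  The basepoint itself has position 0 in both diagrams; it is excluded here because the formula
  would give it the position \<open>2 * pi\<close>.
\<close>

lemma position_mirror_image:
  assumes v: "norm v = 1" and b: "basepoint D \<in> sphere 0 1"
    and z: "z \<in> sphere 0 1" "z \<noteq> basepoint D"
  shows "position (mirror_image v D) (reflection v z) = 2 * pi - position D z"
proof -
  let ?w = "z / basepoint D"
  have "v \<noteq> 0" using v by auto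
  then have "reflection v z / reflection v (basepoint D) = cnj ?w"
    by (simp add: reflection_def)
  moreover have "Arg2pi (cnj ?w) = 2 * pi - Arg2pi ?w"
  proof (cases "?w \<in> \<real>")
    \<comment> \<open>The only real point of the circle other than 1 is -1, at half a turn from the basepoint.\<close>
    case True
    have "norm ?w = 1" "?w \<noteq> 1"
      using b z by (auto simp: norm_divide)
    then have "Arg2pi ?w \<noteq> 0"
      using complex_norm_eq_1_exp[of ?w] by auto
    then have "Arg2pi ?w = pi"
      using True Arg2pi_eq_0_pi by blast
    with True show ?thesis by (simp add: Arg2pi_cnj del: complex_cnj_divide)
  next
    case False
    then show ?thesis by (simp add: Arg2pi_cnj del: complex_cnj_divide)
  qed
  ultimately show ?thesis
    by (simp add: position_def mirror_image_def)
qed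

lemma Min_diff_left:
  fixes f :: "'a \<Rightarrow> 'b :: linordered_ab_group_add"
  assumes "finite S" and "S \<noteq> {}"
  shows "Min ((\<lambda>x. a - f x) ` S) = a - Max (f ` S)"
proof (rule Min_eqI)
  have "Max (f ` S) \<in> f ` S" using assms by (intro Max_in) auto
  then show "a - Max (f ` S) \<in> (\<lambda>x. a - f x) ` S" by auto
qed (use assms in auto)

lemma Max_diff_left:
  fixes f :: "'a \<Rightarrow> 'b :: linordered_ab_group_add"
  assumes "finite S" and "S \<noteq> {}"
  shows "Max ((\<lambda>x. a - f x) ` S) = a - Min (f ` S)"
proof (rule Max_eqI)
  have "Min (f ` S) \<in> f ` S" using assms by (intro Min_in) auto
  then show "a - Min (f ` S) \<in> (\<lambda>x. a - f x) ` S" by auto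
qed (use assms in auto)

lemma
  assumes D: "D \<in> based_chord_diagrams" and v: "norm v = 1" and c: "c \<in> chords D"
  shows first_position_mirror_image:
      "first_position (mirror_image v D) (reflection v ` c) = 2 * pi - last_position D c"
    and last_position_mirror_image:
      "last_position (mirror_image v D) (reflection v ` c) = 2 * pi - first_position D c"
proof -
  have b: "basepoint D \<in> sphere 0 1" and sub: "c \<subseteq> sphere 0 1 - {basepoint D}" and card: "card c = 2"
    using D c by (auto simp: based_chord_diagrams_def)
  from card have fin: "finite c" "c \<noteq> {}"
    by (auto intro: card_ge_0_finite)
  have "position (mirror_image v D) ` reflection v ` c = (\<lambda>z. 2 * pi - position D z) ` c"
    unfolding image_image by (intro image_cong refl position_mirror_image[OF v b]) (use sub in blast)+
  then show "first_position (mirror_image v D) (reflection v ` c) = 2 * pi - last_position D c"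
    and "last_position (mirror_image v D) (reflection v ` c) = 2 * pi - first_position D c"
    by (simp_all add: first_position_def last_position_def Min_diff_left[OF fin] Max_diff_left[OF fin])
qed

text \<open>
  The arguments are exchanged on the right: for crossing chords, comparing last endpoints is the
  same as comparing first endpoints, and the reflection reverses the comparison.
\<close>

lemma chord_sign_mirror_image:
  assumes "D \<in> based_chord_diagrams" and "norm v = 1" and "c \<in> chords D" and "d \<in> chords D"
  shows "chord_sign (mirror_image v D) (reflection v ` c) (reflection v ` d) = chord_sign D d c"
  using assms
  by (auto simp: chord_sign_def chords_cross_def first_position_mirror_image last_position_mirror_image)

section \<open>Invariance under mirror image\<close>

theorem theorem5:
  fixes D :: chord_diagram and v :: complex
  assumes "D \<in> based_chord_diagrams"
    and "norm v = 1"
  shows "skew_char_poly (intersection_graph D) =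
         skew_char_poly (intersection_graph (mirror_image v D))"
proof -
  let ?M = "mirror_image v D" and ?r = "(`) (reflection v)"
  let ?n = "card (chords D)"
  let ?A = "skew_adjacency_matrix (intersection_graph D)"
  let ?B = "skew_adjacency_matrix (intersection_graph ?M)"
  note D = assms(1) and v = assms(2)
  note M = mirror_image_in_based_chord_diagrams[OF D v]
  have "inj ?r"
    using inj_reflection[OF v] by (simp add: inj_image_eq_iff inj_def)
  then have r: "bij_betw ?r (chords D) (chords ?M)"
    by (auto simp: bij_betw_def mirror_image_def intro: inj_on_subset)
  then have card: "card (chords ?M) = ?n"
    by (simp add: bij_betw_same_card)
  have A: "?A \<in> carrier_mat ?n ?n" and B: "?B \<in> carrier_mat ?n ?n"
    using skew_adjacency_matrix_carrier[OF D] skew_adjacency_matrix_carrier[OF M] card by simp_all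
  have f: "bij_betw (chord_index D) (chords D) {0..<?n}"
    by (rule bij_betw_chord_index[OF D])
  have g: "bij_betw (chord_index ?M \<circ> ?r) (chords D) {0..<?n}"
    using bij_betw_trans[OF r bij_betw_chord_index[OF M]] card by simp
  have "?A\<^sup>T $$ (chord_index D c, chord_index D d) =
      ?B $$ ((chord_index ?M \<circ> ?r) c, (chord_index ?M \<circ> ?r) d)"
    if c: "c \<in> chords D" and d: "d \<in> chords D" for c d
  proof -
    have "?A\<^sup>T $$ (chord_index D c, chord_index D d) = chord_sign D d c"
      using A bij_betwE[OF f] c d skew_adjacency_matrix_chord_index[OF D d c] by auto
    also have "\<dots> = chord_sign ?M (?r c) (?r d)"
      using chord_sign_mirror_image[OF D v c d] by simp
    also have "\<dots> = ?B $$ (chord_index ?M (?r c), chord_index ?M (?r d))"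
      using bij_betwE[OF r] c d by (intro skew_adjacency_matrix_chord_index[OF M, symmetric]) auto
    finally show ?thesis by simp
  qed
  then have "char_poly ?A\<^sup>T = char_poly ?B"
    using A by (intro char_poly_eq_if_reindexed[OF _ B f g]) simp_all
  then show ?thesis
    using A by (simp add: skew_char_poly_def)
qed

end
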